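(* Let $s,m$ be positive integers and let $n_1,n_2$ satisfy one of the following three conditions: (1) $n_1=2s$, $n_2=2m$ and $m-1<2s$; (2) $n_1=n_2=2s$; (3) $n_1=2s+1$, $n_2=2m$ and $s<m-1<2s+1$. Then for all sufficiently large $n_0$ (i.e. for all $n_0\ge N$, for some $N$ depending only on $n_1,n_2$), $$R(C_{n_0},P_{n_1},P_{n_2})=n_0+\Big\lfloor\frac{n_1}{2}\Big\rfloor+\Big\lfloor\frac{n_2}{2}\Big\rfloor-2.$$
   Context: All graphs are finite, simple and undirected. $P_n$ and $C_n$ denote the path and the cycle on $n$ vertices. For graphs $G_1,\ldots,G_k$, the multicolor Ramsey number $R(G_1,\ldots,G_k)$ is the smallest integer $n$ such that every coloring of the edges of the complete graph $K_n$ with $k$ colors contains a monochromatic copy of $G_i$ in color $i$ for some $1\le i\le k$ (a copy means a not necessarily induced subgraph). *)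

theory Defs
  imports "HOL-Library.Ramsey"
begin

record 'a ugraph =
  verts :: "'a set"
  edges :: "'a set set"

definition simple_graph :: "'a ugraph \<Rightarrow> bool" where
  "simple_graph G \<longleftrightarrow> finite (verts G) \<and> edges G \<subseteq> [verts G]\<^bsup>2\<^esup>"

definition path_graph :: "nat \<Rightarrow> nat ugraph" where
  "path_graph n = \<lparr>verts = {..<n}, edges = {{i, Suc i} |i. Suc i < n}\<rparr>"

text \<open>The following is a cycle only for \<open>n \<ge> 3\<close>.\<close>

definition cycle_graph :: "nat \<Rightarrow> nat ugraph" where
  "cycle_graph n = \<lparr>verts = {..<n}, edges = {{i, Suc i mod n} |i. i < n}\<rparr>"

definition contains_copy :: "'a ugraph \<Rightarrow> 'b ugraph \<Rightarrow> bool" where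
  "contains_copy G H \<longleftrightarrow>
     (\<exists>\<phi>. inj_on \<phi> (verts H) \<and> \<phi> ` verts H \<subseteq> verts G \<and> (\<forall>e\<in>edges H. \<phi> ` e \<in> edges G))"

definition colour_class :: "nat \<Rightarrow> (nat set \<Rightarrow> nat) \<Rightarrow> nat \<Rightarrow> nat ugraph" where
  "colour_class n c i = \<lparr>verts = {..<n}, edges = {e \<in> [{..<n}]\<^bsup>2\<^esup>. c e = i}\<rparr>"

text \<open>Colours are the indices \<open>0, \<dots>, k - 1\<close> of the \<open>k\<close> graphs in the list.\<close>

definition ramsey_arrows :: "nat \<Rightarrow> nat ugraph list \<Rightarrow> bool" where
  "ramsey_arrows n Gs \<longleftrightarrow>
     (\<forall>c \<in> [{..<n}]\<^bsup>2\<^esup> \<rightarrow> {..<length Gs}.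
        \<exists>i<length Gs. contains_copy (colour_class n c i) (Gs ! i))"

definition ramsey_number :: "nat ugraph list \<Rightarrow> nat" where
  "ramsey_number Gs = (LEAST n. ramsey_arrows n Gs)"

lemma simple_graph_path_graph: "simple_graph (path_graph n)"
  by (auto simp: simple_graph_def path_graph_def nsets_def)

lemma simple_graph_cycle_graph:
  assumes "n \<ge> 3"
  shows "simple_graph (cycle_graph n)"
proof -
  have "Suc i mod n \<noteq> i" if "i < n" for i
    using that assms by (cases "Suc i = n") auto
  then show ?thesis
    using assms by (fastforce simp: simple_graph_def cycle_graph_def nsets_def card_insert_if)
qed

lemma simple_graph_colour_class: "simple_graph (colour_class n c i)"
  by (auto simp: simple_graph_def colour_class_def)

end

theory Submission
  imports Defs
begin

text \<open>
  Put \<open>a = n\<^sub>1 div 2\<close>, \<open>b = n\<^sub>2 div 2\<close> and \<open>p = a + b - 1\<close>. The formula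
  \<open>n\<^sub>0 + a + b - 2\<close> holds for all \<open>n\<^sub>1, n\<^sub>2 \<ge> 2\<close> as soon as \<open>n\<^sub>0\<close> is large
  (\<open>ramsey_number_cycle_path_path\<close>).

  Lower bound (\<open>not_ramsey_arrows\<close>): a path on \<open>n\<^sub>1\<close> vertices has \<open>a\<close> disjoint edges, so every
  vertex cover of it has at least \<open>a\<close> elements. Give colour 1 to all edges that meet a fixed set of
  \<open>a - 1\<close> vertices, colour 2 to the other edges that meet a further set of \<open>b - 1\<close> vertices, and
  colour 0 to the rest; the edges of colour 0 live on the remaining, at most \<open>n\<^sub>0 - 1\<close> vertices.

  Upper bound (\<open>ramsey_arrows_large\<close>): suppose that colours 1 and 2 contain no forbidden path.
  If \<open>S\<close> and \<open>T\<close> are disjoint, \<open>S\<close> has \<open>p\<close> vertices, \<open>T\<close> is huge, and no edge of colour 0 joins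
  them, then by pigeonhole more than \<open>p\<close> vertices of \<open>T\<close> see \<open>S\<close> with the same colour pattern. As
  \<open>p = (a - 1) + (b - 1) + 1\<close>, this pattern has \<open>a\<close> entries 1 or \<open>b\<close> entries 2, and a
  monochromatic complete bipartite graph with \<open>a\<close> (or \<open>b\<close>) vertices on one side and more on the
  other contains the forbidden path (\<open>two_coloured_bipartite_path\<close>). Hence colour 0 has no such
  ``bipartite hole'' \<open>(S, T)\<close>. In particular fewer than \<open>p\<close> vertices have small degree in colour 0,
  since \<open>p\<close> of them would form a hole with their common non-neighbours (\<open>few_small_degrees\<close>).
  There are \<open>n\<^sub>0 + (p - 1)\<close> vertices, so the vertices of small degree can be deleted, with others if
  necessary, until exactly \<open>n\<^sub>0\<close> remain. The remaining graph has large minimum degree and no large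
  bipartite hole, and this forces a Hamilton cycle (\<open>hamilton_cycle_if_no_bipartite_hole\<close>, a weak
  form of a theorem of McDiarmid and Yolov), which is the required cycle of length \<open>n\<^sub>0\<close>.
\<close>

section \<open>Copies of paths and cycles from vertex lists\<close>

abbreviation adj :: "'a ugraph \<Rightarrow> 'a \<Rightarrow> 'a \<Rightarrow> bool" where
  "adj G x y \<equiv> {x, y} \<in> edges G"

lemma contains_copy_path_graphI:
  assumes "distinct xs" "set xs \<subseteq> verts G" "successively (adj G) xs" "k \<le> length xs"
  shows "contains_copy G (path_graph k)"
  unfolding contains_copy_def
proof (intro exI[of _ "\<lambda>i. xs ! i"] conjI ballI)
  show "inj_on ((!) xs) (verts (path_graph k))"
    using assms by (auto simp: path_graph_def inj_on_def nth_eq_iff_index_eq)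
  show "(!) xs ` verts (path_graph k) \<subseteq> verts G"
    using assms by (auto simp: path_graph_def subset_iff)
  show "(!) xs ` e \<in> edges G" if "e \<in> edges (path_graph k)" for e
    using assms that by (auto simp: path_graph_def successively_conv_nth)
qed

lemma contains_copy_cycle_graphI:
  assumes "distinct xs" "set xs \<subseteq> verts G" "successively (adj G) xs" "adj G (last xs) (hd xs)"
  shows "contains_copy G (cycle_graph (length xs))"
  unfolding contains_copy_def
proof (intro exI[of _ "\<lambda>i. xs ! i"] conjI ballI)
  show "inj_on ((!) xs) (verts (cycle_graph (length xs)))"
    using assms by (auto simp: cycle_graph_def inj_on_def nth_eq_iff_index_eq)
  show "(!) xs ` verts (cycle_graph (length xs)) \<subseteq> verts G"
    using assms by (auto simp: cycle_graph_def subset_iff)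
  show "(!) xs ` e \<in> edges G" if e: "e \<in> edges (cycle_graph (length xs))" for e
  proof -
    obtain i where i: "i < length xs" "e = {i, Suc i mod length xs}"
      using e by (auto simp: cycle_graph_def)
    show ?thesis
    proof (cases "Suc i = length xs")
      case True
      then have "last xs = xs ! i" "hd xs = xs ! 0"
        by (metis diff_Suc_1 last_conv_nth length_0_conv nat.distinct(1))
          (use True in \<open>simp add: hd_conv_nth flip: length_greater_0_conv\<close>)
      with i True assms show ?thesis by auto
    next
      case False
      with i assms show ?thesis by (auto simp: successively_conv_nth)
    qed
  qed
qed

section \<open>The lower bound\<close>

text \<open>
  The disjoint edges \<open>{2 * i, Suc (2 * i)}\<close> of the path each need their own element of the cover.
\<close>

lemma path_graph_cover_bound:
  assumes copy: "contains_copy G (path_graph k)" and "finite A"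
    and cover: "\<And>e. e \<in> edges G \<Longrightarrow> e \<inter> A \<noteq> {}"
  shows "k div 2 \<le> card A"
proof -
  obtain \<phi> where inj: "inj_on \<phi> {..<k}"
    and edges: "\<forall>e\<in>{{i, Suc i} |i. Suc i < k}. \<phi> ` e \<in> edges G"
    using copy by (auto simp: contains_copy_def path_graph_def)
  have edge: "{\<phi> i, \<phi> (Suc i)} \<in> edges G" if "Suc i < k" for i
    using bspec[OF edges, of "{i, Suc i}"] that by auto
  \<comment> \<open>For \<open>i < k div 2\<close>, \<open>f i\<close> is an end of the \<open>i\<close>-th of the disjoint edges that is mapped into the cover.\<close>
  define f where "f i = (if \<phi> (2 * i) \<in> A then 2 * i else Suc (2 * i))" for i
  have f: "f i < k" "\<phi> (f i) \<in> A" "f i div 2 = i" if "i < k div 2" for i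
    using edge[of "2 * i"] cover[of "{\<phi> (2 * i), \<phi> (Suc (2 * i))}"] that by (auto simp: f_def)
  have "inj_on (\<phi> \<circ> f) {..<k div 2}"
  proof (rule comp_inj_on)
    show "inj_on f {..<k div 2}"
      using f(3) by (metis inj_onI lessThan_iff)
    show "inj_on \<phi> (f ` {..<k div 2})"
      using f(1) by (auto intro: inj_on_subset[OF inj])
  qed
  moreover have "(\<phi> \<circ> f) ` {..<k div 2} \<subseteq> A"
    using f(2) by auto
  ultimately show ?thesis
    using card_inj_on_le[OF _ _ \<open>finite A\<close>] by fastforce
qed

lemma cycle_graph_vertex_bound:
  assumes copy: "contains_copy G (cycle_graph n)" and "finite A"
    and edges: "\<And>e. e \<in> edges G \<Longrightarrow> e \<subseteq> A"
  shows "n \<le> card A"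
proof -
  obtain \<phi> where inj: "inj_on \<phi> {..<n}"
    and edge: "\<forall>e\<in>{{i, Suc i mod n} |i. i < n}. \<phi> ` e \<in> edges G"
    using copy by (auto simp: contains_copy_def cycle_graph_def)
  have "\<phi> i \<in> A" if "i < n" for i
    using edges[OF bspec[OF edge, of "{i, Suc i mod n}"]] that by auto
  then have "\<phi> ` {..<n} \<subseteq> A"
    by auto
  then show ?thesis
    using card_inj_on_le[OF inj _ \<open>finite A\<close>] by simp
qed

text \<open>
  The hypothesis on \<open>n\<^sub>0\<close> excludes the empty cycle, which has a copy in every graph.
\<close>

lemma not_ramsey_arrows:
  assumes "n\<^sub>0 \<ge> 1" "n\<^sub>1 \<ge> 2" "n\<^sub>2 \<ge> 2" and k: "k < n\<^sub>0 + n\<^sub>1 div 2 + n\<^sub>2 div 2 - 2"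
  shows "\<not> ramsey_arrows k [cycle_graph n\<^sub>0, path_graph n\<^sub>1, path_graph n\<^sub>2]"
proof
  define a b where "a = n\<^sub>1 div 2 - 1" and "b = n\<^sub>2 div 2 - 1"
  define c :: "nat set \<Rightarrow> nat" where
    "c e = (if e \<inter> {..<a} \<noteq> {} then 1 else if e \<inter> {a..<a + b} \<noteq> {} then 2 else 0)" for e
  assume "ramsey_arrows k [cycle_graph n\<^sub>0, path_graph n\<^sub>1, path_graph n\<^sub>2]"
  moreover have "c \<in> [{..<k}]\<^bsup>2\<^esup> \<rightarrow> {..<3}"
    by (auto simp: c_def)
  ultimately obtain i where i: "i < 3"
    "contains_copy (colour_class k c i) ([cycle_graph n\<^sub>0, path_graph n\<^sub>1, path_graph n\<^sub>2] ! i)"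
    unfolding ramsey_arrows_def by (auto simp: numeral_3_eq_3)
  consider "contains_copy (colour_class k c 0) (cycle_graph n\<^sub>0)"
    | "contains_copy (colour_class k c 1) (path_graph n\<^sub>1)"
    | "contains_copy (colour_class k c 2) (path_graph n\<^sub>2)"
    using i by (auto simp: less_Suc_eq numeral_3_eq_3 numeral_2_eq_2)
  then show False
  proof cases
    case 1
    then have "n\<^sub>0 \<le> card {a + b..<k}"
      by (rule cycle_graph_vertex_bound)
        (force simp: colour_class_def c_def nsets_def split: if_splits)+
    with assms show False by (simp add: a_def b_def)
  next
    case 2
    then have "n\<^sub>1 div 2 \<le> card {..<a}"
      by (rule path_graph_cover_bound) (auto simp: colour_class_def c_def split: if_splits)
    with assms show False by (simp add: a_def)
  next
    case 3
    then have "n\<^sub>2 div 2 \<le> card {a..<a + b}"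
      by (rule path_graph_cover_bound) (auto simp: colour_class_def c_def split: if_splits)
    with assms show False by (simp add: b_def)
  qed
qed

section \<open>Complete bipartite graphs in two colours\<close>

lemma successively_splice:
  assumes "symp R" and "length xs = length ys \<or> length xs = Suc (length ys)"
    and "\<And>x y. x \<in> set xs \<Longrightarrow> y \<in> set ys \<Longrightarrow> R x y"
  shows "successively R (splice xs ys)"
  using assms(2,3)
proof (induction xs ys rule: splice.induct)
  case (1 ys)
  then show ?case by simp
next
  case (2 x xs ys)
  have "successively R (splice ys xs)"
  proof (rule "2.IH")
    show "R u v" if "u \<in> set ys" "v \<in> set xs" for u v
      using that "2.prems"(2)[of v u] \<open>symp R\<close> by (auto dest: sympD)
  qed (use "2.prems" in auto)
  moreover have "R x (hd (splice ys xs))" if "splice ys xs \<noteq> []"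
    using 2 that by (cases ys) auto
  ultimately show ?case
    by (auto simp: successively_Cons)
qed

text \<open>
  The path alternates between the two sides; starting and ending on the larger side gives
  \<open>2 * a + 1\<close> vertices, so that \<open>k\<close> and \<open>k div 2\<close> can be related without regard to parity.
\<close>

lemma contains_copy_path_graph_bipartite:
  assumes "finite A" "finite B" "A \<inter> B = {}" "A \<union> B \<subseteq> verts G"
    and "card A \<ge> a" "card B \<ge> Suc a" "k \<le> 2 * a + 1"
    and adj: "\<And>x y. x \<in> A \<Longrightarrow> y \<in> B \<Longrightarrow> adj G x y"
  shows "contains_copy G (path_graph k)"
proof -
  obtain A' B' where A': "A' \<subseteq> A" "card A' = a" "finite A'" and B': "B' \<subseteq> B" "card B' = Suc a" "finite B'"
    using obtain_subset_with_card_n[OF \<open>card A \<ge> a\<close>] obtain_subset_with_card_n[OF \<open>card B \<ge> Suc a\<close>] by metis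
  obtain xs ys where xs: "set xs = A'" "distinct xs" and ys: "set ys = B'" "distinct ys"
    using finite_distinct_list A'(3) B'(3) by metis
  have len: "length xs = a" "length ys = Suc a"
    using xs ys A' B' by (auto simp flip: distinct_card)
  show ?thesis
  proof (rule contains_copy_path_graphI)
    show "distinct (splice ys xs)"
      using xs ys A' B' assms(3) distinct_disjoint_shuffles[of ys xs] splice_in_shuffles[of ys xs] by blast
    show "set (splice ys xs) \<subseteq> verts G"
      using xs ys A' B' assms(4) set_shuffles[OF splice_in_shuffles[of ys xs]] by auto
    show "successively (adj G) (splice ys xs)"
    proof (rule successively_splice)
      show "symp (adj G)" by (auto simp: symp_def insert_commute)
      show "adj G x y" if "x \<in> set ys" "y \<in> set xs" for x y
        using that adj[of y x] xs ys A' B' by (auto simp: insert_commute)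
    qed (use len in simp)
    show "k \<le> length (splice ys xs)"
      using len assms by simp
  qed
qed

lemma pigeonhole_fibre:
  assumes "finite Y" "f ` X \<subseteq> Y" "card X > card Y * m"
  obtains y where "y \<in> Y" "card {x \<in> X. f x = y} > m"
proof (rule ccontr)
  assume contr: "\<not> thesis"
  have "finite X" using assms(3) card.infinite by fastforce
  have "X = (\<Union>y\<in>Y. {x \<in> X. f x = y})" using assms(2) by auto
  then have "card X \<le> (\<Sum>y\<in>Y. card {x \<in> X. f x = y})"
    using card_UN_le[OF assms(1), of "\<lambda>y. {x \<in> X. f x = y}"] by simp
  also have "\<dots> \<le> (\<Sum>y\<in>Y. m)"
    using contr that by (intro sum_mono) (meson not_le)
  finally show False using assms(3) by simp
qed

text \<open>
  The graphs \<open>G\<close> and \<open>H\<close> are the two colours. The size of \<open>T\<close> allows for every one of the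
  \<open>2 ^ (a + b - 1)\<close> possible \<open>G\<close>-neighbourhoods in \<open>S\<close>, and for a class of vertices with a common
  neighbourhood that exceeds both \<open>a\<close> and \<open>b\<close>.
\<close>

lemma two_coloured_bipartite_path:
  assumes "a \<ge> 1" "b \<ge> 1" and "k \<le> 2 * a + 1" "l \<le> 2 * b + 1"
    and fin: "finite S" "finite T" and "S \<inter> T = {}" "S \<union> T \<subseteq> verts G" "S \<union> T \<subseteq> verts H"
    and S: "card S = a + b - 1" and T: "card T > 2 ^ (a + b - 1) * (a + b - 1)"
    and cover: "\<And>x y. x \<in> S \<Longrightarrow> y \<in> T \<Longrightarrow> adj G x y \<or> adj H x y"
  shows "contains_copy G (path_graph k) \<or> contains_copy H (path_graph l)"
proof -
  define f where "f y = {x \<in> S. adj G x y}" for y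
  have "card (Pow S) = 2 ^ (a + b - 1)"
    using fin S by (simp add: card_Pow)
  then obtain P where P: "P \<subseteq> S" and big: "card {y \<in> T. f y = P} > a + b - 1"
    using pigeonhole_fibre[of "Pow S" f T "a + b - 1"] fin T by (force simp: f_def)
  define U where "U = {y \<in> T. f y = P}"
  have U: "finite U" "U \<subseteq> T" "card U > a + b - 1"
    using big fin by (auto simp: U_def)
  have "card P + card (S - P) = a + b - 1"
    using P S fin by (metis card_Diff_subset card_mono finite_subset le_add_diff_inverse)
  then consider "card P \<ge> a" | "card (S - P) \<ge> b" by linarith
  then show ?thesis
  proof cases
    case 1
    have "contains_copy G (path_graph k)"
    proof (rule contains_copy_path_graph_bipartite[OF _ _ _ _ 1])
      show "Suc a \<le> card U" using U assms by linarith
      show "adj G x y" if "x \<in> P" "y \<in> U" for x y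
        using that by (auto simp: U_def f_def)
    qed (use assms U P finite_subset in blast)+
    then show ?thesis ..
  next
    case 2
    have "contains_copy H (path_graph l)"
    proof (rule contains_copy_path_graph_bipartite[OF _ _ _ _ 2])
      show "Suc b \<le> card U" using U assms by linarith
      show "adj H x y" if "x \<in> S - P" "y \<in> U" for x y
        using that cover[of x y] by (auto simp: U_def f_def)
    qed (use assms U P finite_subset in blast)+
    then show ?thesis ..
  qed
qed

section \<open>Hamilton cycles in graphs without large bipartite holes\<close>

text \<open>
  Cutting at the \<open>t\<close>-th smallest element \<open>x\<close> of \<open>I\<close> leaves at least \<open>t\<close> elements of \<open>I\<close> on either
  side, where \<open>x\<close> itself may be counted on both, and at least \<open>t\<close> elements of \<open>J\<close> on one of them.
\<close>

lemma ordered_halves: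
  fixes I J :: "nat set"
  assumes "finite I" "finite J" "t \<ge> 1" "card I \<ge> 2 * t" "card J \<ge> 2 * t"
  obtains I' J' where "I' \<subseteq> I" "J' \<subseteq> J" "card I' = t" "card J' = t"
    "(\<forall>i\<in>I'. \<forall>j\<in>J'. i \<le> j) \<or> (\<forall>i\<in>I'. \<forall>j\<in>J'. j < i)"
proof -
  define x where "x = (LEAST x. card {i \<in> I. i \<le> x} \<ge> t)"
  have "{i \<in> I. i \<le> Max I} = I" using assms by auto
  then have "\<exists>x. card {i \<in> I. i \<le> x} \<ge> t"
    using assms by (intro exI[of _ "Max I"]) simp
  then have low: "card {i \<in> I. i \<le> x} \<ge> t"
    unfolding x_def by (rule LeastI_ex)
  have "card {i \<in> I. i < x} < t"
  proof (cases x)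
    case 0
    then show ?thesis using assms by simp
  next
    case (Suc y)
    then have "\<not> card {i \<in> I. i \<le> y} \<ge> t"
      using not_less_Least[of y "\<lambda>x. card {i \<in> I. i \<le> x} \<ge> t"] by (simp add: x_def)
    then show ?thesis using Suc by (simp add: less_Suc_eq_le)
  qed
  moreover have split: "card {i \<in> K. i < x} + card {i \<in> K. x \<le> i} = card K" if "finite K" for K
  proof -
    have "{i \<in> K. i < x} \<union> {i \<in> K. x \<le> i} = K" by auto
    then show ?thesis using that by (subst card_Un_disjoint[symmetric]) auto
  qed
  ultimately have high: "card {i \<in> I. x \<le> i} \<ge> t"
    using assms split[of I] by linarith
  consider "card {j \<in> J. x \<le> j} \<ge> t" | "card {j \<in> J. j < x} \<ge> t"
    using split[of J] assms by linarith
  then show thesis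
  proof cases
    case 1
    obtain I' J' where "I' \<subseteq> {i \<in> I. i \<le> x}" "card I' = t" "J' \<subseteq> {j \<in> J. x \<le> j}" "card J' = t"
      using obtain_subset_with_card_n[OF low] obtain_subset_with_card_n[OF 1] by metis
    then show thesis by (intro that[of I' J']) (force dest!: subsetD)+
  next
    case 2
    obtain I' J' where "I' \<subseteq> {i \<in> I. x \<le> i}" "card I' = t" "J' \<subseteq> {j \<in> J. j < x}" "card J' = t"
      using obtain_subset_with_card_n[OF high] obtain_subset_with_card_n[OF 2] by metis
    then show thesis by (intro that[of I' J']) (force dest!: subsetD)+
  qed
qed

text \<open>
  Lists of length two count: a single edge, read back and forth, closes up.
\<close>

definition cycle_list :: "('a \<Rightarrow> 'a \<Rightarrow> bool) \<Rightarrow> 'a list \<Rightarrow> bool" where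
  "cycle_list R xs \<longleftrightarrow> xs \<noteq> [] \<and> distinct xs \<and> successively R xs \<and> R (last xs) (hd xs)"

text \<open>
  The next two lemmas close a path \<open>P @ Q @ S\<close> to a cycle on the same vertices by cutting it
  between \<open>P\<close>, \<open>Q\<close> and \<open>S\<close> and adding three edges: one from each end of the path, to vertices
  next to the cuts, and one between the remaining two vertices at the cuts. They differ in whether
  the neighbour of the first vertex precedes the neighbour of the last vertex along the path.
\<close>

lemma cycle_list_reroute_uncrossed:
  assumes "symp R" "distinct (P @ Q @ S)" "successively R (P @ Q @ S)"
    and "P \<noteq> []" "Q \<noteq> []" "S \<noteq> []"
    and "R (hd P) (hd Q)" "R (last S) (last Q)" "R (last P) (hd S)"
  shows "cycle_list R (Q @ rev S @ rev P)"
proof -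
  have "successively (\<lambda>x y. R y x) xs" if "successively R xs" for xs
    using that \<open>symp R\<close> by (auto elim: successively_mono dest: sympD)
  with assms show ?thesis
    by (auto simp: cycle_list_def successively_append_iff hd_rev last_rev hd_append
        intro: sympD[OF \<open>symp R\<close>])
qed

lemma cycle_list_reroute_crossed:
  assumes "symp R" "distinct (P @ Q @ S)" "successively R (P @ Q @ S)"
    and "P \<noteq> []" "Q \<noteq> []" "S \<noteq> []"
    and "R (hd P) (last Q)" "R (last S) (last P)" "R (hd Q) (hd S)"
  shows "cycle_list R (P @ rev S @ Q)"
proof -
  have "successively (\<lambda>x y. R y x) xs" if "successively R xs" for xs
    using that \<open>symp R\<close> by (auto elim: successively_mono dest: sympD)
  with assms show ?thesis
    by (auto simp: cycle_list_def successively_append_iff hd_rev last_rev hd_append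
        intro: sympD[OF \<open>symp R\<close>])
qed

text \<open>
  The first vertex of the path has \<open>2 * t\<close> neighbours on it, and so has the last. By
  \<open>ordered_halves\<close>, \<open>t\<close> neighbours of the first all come before, or all come after, \<open>t\<close> neighbours
  of the last. Replace all these neighbours by suitable vertices next to them: an edge between the
  two resulting sets, which exists because they do not form a bipartite hole, is the third edge
  that one of the two rerouting lemmas asks for.
\<close>

lemma cycle_list_of_path:
  assumes "symp R" "irreflp R" "t \<ge> 1" and xs: "distinct xs" "successively R xs"
    and hole: "\<And>S T. S \<subseteq> set xs \<Longrightarrow> T \<subseteq> set xs \<Longrightarrow> S \<inter> T = {} \<Longrightarrow> card S = t \<Longrightarrow> card T = t
      \<Longrightarrow> \<exists>x\<in>S. \<exists>y\<in>T. R x y"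
    and first: "card {y \<in> set xs. R (hd xs) y} \<ge> 2 * t"
    and last: "card {y \<in> set xs. R (last xs) y} \<ge> 2 * t"
  obtains ys where "cycle_list R ys" "set ys = set xs"
proof -
  define k where "k = length xs"
  \<comment> \<open>The neighbours of \<open>z\<close> on the path, given by their positions.\<close>
  define I where "I z = {i. i < k \<and> R z (xs ! i)}" for z
  have nbrs: "(!) xs ` I z = {y \<in> set xs. R z y}" for z
    by (auto simp: I_def k_def in_set_conv_nth)
  have inj: "inj_on ((!) xs) {..<k}"
    using xs by (auto simp: inj_on_def k_def nth_eq_iff_index_eq)
  have fin: "finite (I z)" for z by (simp add: I_def)
  have "card {y \<in> set xs. R z y} \<le> card (I z)" for z
    using card_image_le[OF fin, of "(!) xs"] by (simp flip: nbrs)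
  then have cards: "card (I (hd xs)) \<ge> 2 * t" "card (I (List.last xs)) \<ge> 2 * t"
    using first last order_trans by blast+
  then have "k > 0" using \<open>t \<ge> 1\<close> by (auto simp: I_def intro: gr0I)
  then have ne: "xs \<noteq> []" by (auto simp: k_def)
  have hd: "hd xs = xs ! 0" and lst: "List.last xs = xs ! (k - 1)"
    using ne by (simp_all add: hd_conv_nth last_conv_nth k_def)
  have irr: "\<not> R z z" for z using \<open>irreflp R\<close> by (simp add: irreflp_def)
  show thesis
  proof (cases "R (List.last xs) (hd xs)")
    case True
    then show thesis using that[of xs] xs ne by (simp add: cycle_list_def)
  next
    case False
    then have not_ends: "\<not> R (hd xs) (List.last xs)" using \<open>symp R\<close> by (auto dest: sympD)
    have I: "0 < i" "Suc i < k" "R (hd xs) (xs ! i)" if "i \<in> I (hd xs)" for i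
    proof -
      have "i < k" and e: "R (hd xs) (xs ! i)" using that by (auto simp: I_def)
      moreover have "i \<noteq> 0" using e irr[of "hd xs"] by (metis hd)
      moreover have "i \<noteq> k - 1" using e not_ends by (metis lst)
      ultimately show "0 < i" "Suc i < k" "R (hd xs) (xs ! i)" by auto
    qed
    have J: "Suc j < k" "R (List.last xs) (xs ! j)" if "j \<in> I (List.last xs)" for j
    proof -
      have "j < k" and e: "R (List.last xs) (xs ! j)" using that by (auto simp: I_def)
      moreover have "j \<noteq> k - 1" using e irr[of "List.last xs"] by (metis lst)
      ultimately show "Suc j < k" "R (List.last xs) (xs ! j)" by auto
    qed
    obtain I' J' where sub: "I' \<subseteq> I (hd xs)" "J' \<subseteq> I (List.last xs)" and card: "card I' = t" "card J' = t"
      and order: "(\<forall>i\<in>I'. \<forall>j\<in>J'. i \<le> j) \<or> (\<forall>i\<in>I'. \<forall>j\<in>J'. j < i)"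
      using ordered_halves[OF fin fin \<open>t \<ge> 1\<close> cards] by metis
    \<comment> \<open>Here \<open>f\<close> and \<open>g\<close> are the shifts by one position that lead to the vertices at the cuts.\<close>
    have edge: "\<exists>i\<in>I'. \<exists>j\<in>J'. R (xs ! f i) (xs ! g j)"
      if "inj_on f I'" "inj_on g J'" "f ` I' \<subseteq> {..<k}" "g ` J' \<subseteq> {..<k}" "f ` I' \<inter> g ` J' = {}" for f g
    proof -
      have "card ((!) xs ` f ` I') = t" "card ((!) xs ` g ` J') = t"
        using that card by (auto simp: card_image inj_on_subset[OF inj])
      moreover have "(!) xs ` f ` I' \<inter> (!) xs ` g ` J' = {}"
        using that inj_on_image_Int[OF inj, of "f ` I'" "g ` J'"] by simp
      moreover have "(!) xs ` f ` I' \<subseteq> set xs" "(!) xs ` g ` J' \<subseteq> set xs"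
        using that by (auto simp: k_def)
      ultimately show ?thesis
        using hole[of "(!) xs ` f ` I'" "(!) xs ` g ` J'"] by blast
    qed
    from order show thesis
    proof
      assume le: "\<forall>i\<in>I'. \<forall>j\<in>J'. i \<le> j"
      have "\<exists>i\<in>I'. \<exists>j\<in>J'. R (xs ! (i - 1)) (xs ! Suc j)"
      proof (rule edge)
        show "inj_on (\<lambda>i. i - 1) I'"
          using sub(1) I(1) by (intro inj_on_diff_nat) fastforce
        show "(\<lambda>i. i - 1) ` I' \<subseteq> {..<k}" using sub I(2) by fastforce
        show "Suc ` J' \<subseteq> {..<k}" using sub J(1) by fastforce
        show "(\<lambda>i. i - 1) ` I' \<inter> Suc ` J' = {}" using le by fastforce
      qed auto
      then obtain i j where ij: "i \<in> I'" "j \<in> J'" "i \<le> j" and e: "R (xs ! (i - 1)) (xs ! Suc j)"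
        using le by blast
      note i = I[OF subsetD[OF sub(1) ij(1)]] and j = J[OF subsetD[OF sub(2) ij(2)]]
      define P Q S where "P = take i xs" and "Q = take (Suc j - i) (drop i xs)" and "S = drop (Suc j) xs"
      have split: "xs = P @ Q @ S"
        using \<open>i \<le> j\<close> unfolding P_def Q_def S_def
        by (metis append_take_drop_id drop_drop le_SucI le_add_diff_inverse2)
      have ne': "P \<noteq> []" "Q \<noteq> []" "S \<noteq> []"
        using i j ij by (auto simp: P_def Q_def S_def k_def)
      have "cycle_list R (Q @ rev S @ rev P)"
      proof (rule cycle_list_reroute_uncrossed[OF \<open>symp R\<close>])
        have "hd P = hd xs" "hd Q = xs ! i" using i ij
          by (simp_all add: P_def Q_def hd_drop_conv_nth k_def)
        then show "R (hd P) (hd Q)" using i by simp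
        have "List.last S = List.last xs" using j by (simp add: S_def k_def)
        moreover have "length Q = Suc j - i" using j ij by (simp add: Q_def k_def)
        then have "List.last Q = xs ! j"
          using ne'(2) j(1) ij(3) by (simp add: last_conv_nth) (simp add: Q_def k_def Suc_diff_le)
        ultimately show "R (List.last S) (List.last Q)" using j by simp
        have "length P = i" using i by (simp add: P_def k_def)
        then have "List.last P = xs ! (i - 1)"
          using ne'(1) i(1) by (simp add: last_conv_nth) (simp add: P_def)
        moreover have "hd S = xs ! Suc j" using j by (simp add: S_def hd_drop_conv_nth k_def)
        ultimately show "R (List.last P) (hd S)" using e by simp
      qed (use xs ne' in \<open>simp_all flip: split\<close>)
      then show thesis by (rule that) (subst split, auto)
    next
      assume less: "\<forall>i\<in>I'. \<forall>j\<in>J'. j < i"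
      have "\<exists>i\<in>I'. \<exists>j\<in>J'. R (xs ! Suc i) (xs ! Suc j)"
      proof (rule edge)
        show "Suc ` I' \<subseteq> {..<k}" using sub I(2) by fastforce
        show "Suc ` J' \<subseteq> {..<k}" using sub J(1) by fastforce
        show "Suc ` I' \<inter> Suc ` J' = {}" using less by fastforce
      qed auto
      then obtain i j where ij: "i \<in> I'" "j \<in> J'" "j < i" and e: "R (xs ! Suc i) (xs ! Suc j)"
        using less by blast
      note i = I[OF subsetD[OF sub(1) ij(1)]] and j = J[OF subsetD[OF sub(2) ij(2)]]
      define P Q S where "P = take (Suc j) xs" and "Q = take (i - j) (drop (Suc j) xs)" and "S = drop (Suc i) xs"
      have "Suc i = (i - j) + Suc j" using ij by simp
      then have split: "xs = P @ Q @ S"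
        unfolding P_def Q_def S_def by (metis append_take_drop_id drop_drop)
      have ne': "P \<noteq> []" "Q \<noteq> []" "S \<noteq> []"
        using i j ij by (auto simp: P_def Q_def S_def k_def)
      have "cycle_list R (P @ rev S @ Q)"
      proof (rule cycle_list_reroute_crossed[OF \<open>symp R\<close>])
        have "hd P = hd xs" by (simp add: P_def)
        moreover have "length Q = i - j" using i ij by (simp add: Q_def k_def)
        then have "List.last Q = xs ! i"
          using ne'(2) i(2) ij(3) by (simp add: last_conv_nth) (simp add: Q_def k_def)
        ultimately show "R (hd P) (List.last Q)" using i by simp
        have "List.last S = List.last xs" "List.last P = xs ! j" using i j
          by (simp_all add: S_def P_def k_def take_Suc_conv_app_nth)
        then show "R (List.last S) (List.last P)" using j by simp
        have "hd Q = xs ! Suc j" "hd S = xs ! Suc i" using i j ij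
          by (simp_all add: S_def Q_def hd_drop_conv_nth k_def)
        then show "R (hd Q) (hd S)" using e \<open>symp R\<close> by (auto dest: sympD)
      qed (use xs ne' in \<open>simp_all flip: split\<close>)
      then show thesis by (rule that) (subst split, auto)
    qed
  qed
qed

text \<open>
  Opening the cycle next to \<open>x\<close> and prepending \<open>z\<close> gives a path with one vertex more.
\<close>

lemma cycle_list_extend_path:
  assumes "cycle_list R ys" "x \<in> set ys" "z \<notin> set ys" "R z x"
  obtains zs where "distinct zs" "successively R zs" "set zs = insert z (set ys)"
proof -
  obtain us vs where ys: "ys = us @ x # vs" using \<open>x \<in> set ys\<close> by (auto simp: in_set_conv_decomp)
  have "us = [] \<or> R (last (x # vs)) (hd us)"
    using assms(1) by (cases us) (auto simp: ys cycle_list_def)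
  then have "successively R (z # (x # vs) @ us)"
    using assms(1,4) by (auto simp: ys cycle_list_def successively_append_iff successively_Cons hd_append)
  then show thesis
    using assms by (intro that[of "z # (x # vs) @ us"]) (auto simp: ys cycle_list_def)
qed

text \<open>
  Take a longest path. All neighbours of its two ends lie on it, so its vertices span a cycle by
  \<open>cycle_list_of_path\<close>. By maximality no edge leaves this cycle. Hence a vertex off the cycle has
  all its \<open>2 * t\<close> neighbours off the cycle, and \<open>t\<close> vertices off the cycle together with \<open>t\<close>
  vertices on it form a bipartite hole. So the cycle is a Hamilton cycle.
\<close>

theorem hamilton_cycle_if_no_bipartite_hole:
  assumes "symp R" "irreflp R" "t \<ge> 1" and W: "finite W" "W \<noteq> {}"
    and deg: "\<And>x. x \<in> W \<Longrightarrow> card {y \<in> W. R x y} \<ge> 2 * t"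
    and hole: "\<And>S T. S \<subseteq> W \<Longrightarrow> T \<subseteq> W \<Longrightarrow> S \<inter> T = {} \<Longrightarrow> card S = t \<Longrightarrow> card T = t
      \<Longrightarrow> \<exists>x\<in>S. \<exists>y\<in>T. R x y"
  obtains ys where "cycle_list R ys" "set ys = W"
proof -
  define path where "path xs \<longleftrightarrow> distinct xs \<and> successively R xs \<and> set xs \<subseteq> W" for xs
  obtain w where "w \<in> W" using W by auto
  then have "path [w]" by (simp add: path_def)
  moreover have "length xs < Suc (card W)" if "path xs" for xs
    using that W by (metis card_mono distinct_card less_Suc_eq_le path_def)
  ultimately obtain xs where xs: "path xs" and longest: "\<And>ys. path ys \<Longrightarrow> length ys \<le> length xs"
    using ex_has_greatest_nat[of path "[w]" length "Suc (card W)"] by blast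
  have "length xs \<ge> 1" using longest[OF \<open>path [w]\<close>] by simp
  then have ne: "xs \<noteq> []" by auto
  then have ends: "hd xs \<in> W" "last xs \<in> W" using xs by (auto simp: path_def)
  have "y \<in> set xs" if "y \<in> W" "R (hd xs) y" for y
  proof (rule ccontr)
    assume "y \<notin> set xs"
    then have "path (y # xs)"
      using xs that ne \<open>symp R\<close> by (auto simp: path_def successively_Cons dest: sympD)
    from longest[OF this] show False by simp
  qed
  then have "{y \<in> set xs. R (hd xs) y} = {y \<in> W. R (hd xs) y}" using xs by (auto simp: path_def)
  then have first: "card {y \<in> set xs. R (hd xs) y} \<ge> 2 * t"
    using deg[of "hd xs"] ends by simp
  have "y \<in> set xs" if "y \<in> W" "R (last xs) y" for y
  proof (rule ccontr)
    assume "y \<notin> set xs"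
    then have "path (xs @ [y])"
      using xs that ne by (auto simp: path_def successively_append_iff)
    from longest[OF this] show False by simp
  qed
  then have "{y \<in> set xs. R (last xs) y} = {y \<in> W. R (last xs) y}" using xs by (auto simp: path_def)
  then have last: "card {y \<in> set xs. R (last xs) y} \<ge> 2 * t"
    using deg[of "last xs"] ends by simp
  have "set xs \<subseteq> W" using xs by (simp add: path_def)
  obtain ys where ys: "cycle_list R ys" "set ys = set xs"
  proof (rule cycle_list_of_path[OF assms(1-3) _ _ _ first last])
    show "\<exists>x\<in>S. \<exists>y\<in>T. R x y"
      if "S \<subseteq> set xs" "T \<subseteq> set xs" "S \<inter> T = {}" "card S = t" "card T = t" for S T
      using that hole[of S T] \<open>set xs \<subseteq> W\<close> by blast
  qed (use xs in \<open>auto simp: path_def\<close>)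
  have no_edge: "\<not> R z x" if "x \<in> set xs" "z \<in> W - set xs" for x z
  proof
    assume "R z x"
    moreover have "x \<in> set ys" "z \<notin> set ys" using that ys(2) by auto
    ultimately obtain zs where zs: "distinct zs" "successively R zs" "set zs = insert z (set ys)"
      using cycle_list_extend_path[OF ys(1)] by metis
    then have "path zs" using \<open>set xs \<subseteq> W\<close> that ys(2) by (auto simp: path_def)
    moreover have "length zs = Suc (length xs)"
      using zs that xs ys(2) by (simp add: path_def flip: distinct_card)
    ultimately show False using longest[of zs] by simp
  qed
  have "W - set xs = {}"
  proof (rule ccontr)
    assume "W - set xs \<noteq> {}"
    then obtain z where z: "z \<in> W - set xs" by auto
    then have "{y \<in> W. R z y} \<subseteq> W - set xs" using no_edge by auto
    then have "2 * t \<le> card (W - set xs)"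
      using deg[of z] z W by (meson DiffD1 card_mono finite_Diff order_trans)
    then obtain T where T: "T \<subseteq> W - set xs" "card T = t"
      using obtain_subset_with_card_n[of t "W - set xs"] by auto
    have "2 * t \<le> card (set xs)"
      using first by (rule order_trans) (auto intro: card_mono)
    then obtain S where S: "S \<subseteq> set xs" "card S = t"
      using obtain_subset_with_card_n[of t "set xs"] by auto
    have "S \<inter> T = {}" "S \<subseteq> W" "T \<subseteq> W" using S T \<open>set xs \<subseteq> W\<close> by auto
    then obtain x z where "x \<in> S" "z \<in> T" "R x z"
      using hole[of S T] S T by blast
    then show False using no_edge[of x z] S T \<open>symp R\<close> by (auto dest: sympD)
  qed
  then show thesis using that[OF ys(1)] ys(2) \<open>set xs \<subseteq> W\<close> by auto
qed

section \<open>The upper bound\<close>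

text \<open>
  A set \<open>S\<close> of \<open>p\<close> vertices of degree less than \<open>d\<close>, together with its neighbourhood, has at most
  \<open>p + p * d\<close> elements, which leaves \<open>t\<close> common non-neighbours.
\<close>

lemma few_small_degrees:
  assumes "finite V" and "p + p * d + t \<le> card V"
    and hole: "\<And>S T. S \<subseteq> V \<Longrightarrow> T \<subseteq> V \<Longrightarrow> S \<inter> T = {} \<Longrightarrow> card S = p \<Longrightarrow> card T = t
      \<Longrightarrow> \<exists>x\<in>S. \<exists>y\<in>T. R x y"
  shows "card {x \<in> V. card {y \<in> V. R x y} < d} < p"
proof (rule ccontr)
  assume "\<not> ?thesis"
  then obtain S where S: "S \<subseteq> {x \<in> V. card {y \<in> V. R x y} < d}" "card S = p"
    using obtain_subset_with_card_n[of p "{x \<in> V. card {y \<in> V. R x y} < d}"] by auto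
  have "S \<subseteq> V" using S by auto
  then have "finite S" using assms(1) finite_subset by blast
  define U where "U = (\<Union>x\<in>S. {y \<in> V. R x y})"
  have "card U \<le> (\<Sum>x\<in>S. card {y \<in> V. R x y})"
    unfolding U_def using \<open>finite S\<close> by (rule card_UN_le)
  also have "\<dots> \<le> (\<Sum>x\<in>S. d)" using S by (intro sum_mono) auto
  finally have "card (S \<union> U) \<le> p + p * d"
    using card_Un_le[of S U] S by simp
  then have "t \<le> card (V - (S \<union> U))"
    using assms diff_card_le_card_Diff[of "S \<union> U" V] \<open>finite S\<close> by (simp add: U_def)
  then obtain T where T: "T \<subseteq> V - (S \<union> U)" "card T = t"
    using obtain_subset_with_card_n by metis
  then have "\<exists>x\<in>S. \<exists>y\<in>T. R x y"
    using hole[of S T] S \<open>S \<subseteq> V\<close> by blast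
  then show False using T by (auto simp: U_def)
qed

text \<open>
  The \<open>p - 1\<close> surplus vertices are exactly enough to discard all vertices of degree less than
  \<open>2 * t + p\<close>. Every other vertex loses at most \<open>p - 1\<close> neighbours with them, and so keeps the
  \<open>2 * t\<close> that \<open>hamilton_cycle_if_no_bipartite_hole\<close> asks for.
\<close>

lemma cycle_of_prescribed_length:
  assumes "symp R" "irreflp R" "1 \<le> p" "p \<le> t" and "finite V" "card V = n + (p - 1)"
    and n: "p + p * (2 * t + p) + t \<le> n"
    and hole: "\<And>S T. S \<subseteq> V \<Longrightarrow> T \<subseteq> V \<Longrightarrow> S \<inter> T = {} \<Longrightarrow> card S = p \<Longrightarrow> card T = t
      \<Longrightarrow> \<exists>x\<in>S. \<exists>y\<in>T. R x y"
  obtains ys where "cycle_list R ys" "set ys \<subseteq> V" "length ys = n"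
proof -
  define B where "B = {x \<in> V. card {y \<in> V. R x y} < 2 * t + p}"
  have "card B < p"
    unfolding B_def by (rule few_small_degrees[OF \<open>finite V\<close> _ hole]) (use assms in auto)
  then have "card (V - B) \<ge> n"
    using diff_card_le_card_Diff[of B V] assms by (simp add: B_def)
  then obtain W where W: "W \<subseteq> V - B" "card W = n"
    using obtain_subset_with_card_n by metis
  then have fin: "finite W" using assms finite_subset by blast
  have "card (V - W) = p - 1"
    using W assms fin by (subst card_Diff_subset) auto
  obtain ys where ys: "cycle_list R ys" "set ys = W"
  proof (rule hamilton_cycle_if_no_bipartite_hole[OF assms(1,2) _ fin])
    show "t \<ge> 1" "W \<noteq> {}" using assms W by auto
    show "card {y \<in> W. R x y} \<ge> 2 * t" if "x \<in> W" for x
    proof -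
      have "2 * t + p \<le> card {y \<in> V. R x y}" using that W by (auto simp: B_def)
      also have "\<dots> \<le> card ({y \<in> W. R x y} \<union> (V - W))"
        using assms fin by (intro card_mono) auto
      also have "\<dots> \<le> card {y \<in> W. R x y} + (p - 1)"
        using card_Un_le[of "{y \<in> W. R x y}" "V - W"] \<open>card (V - W) = p - 1\<close> by simp
      finally show ?thesis by linarith
    qed
    show "\<exists>x\<in>S. \<exists>y\<in>T. R x y"
      if ST: "S \<subseteq> W" "T \<subseteq> W" "S \<inter> T = {}" "card S = t" "card T = t" for S T
    proof -
      obtain S' where S': "S' \<subseteq> S" "card S' = p"
        using obtain_subset_with_card_n[of p S] ST \<open>p \<le> t\<close> by blast
      then show ?thesis using hole[of S' T] ST W by blast
    qed
  qed
  then show thesis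
    using that[of ys] W distinct_card[of ys] by (auto simp: cycle_list_def)
qed

lemma ramsey_arrows_large:
  fixes n\<^sub>1 n\<^sub>2 :: nat
  defines "p \<equiv> n\<^sub>1 div 2 + n\<^sub>2 div 2 - 1"
  defines "t \<equiv> 2 ^ p * p + 1"
  assumes "n\<^sub>1 \<ge> 2" "n\<^sub>2 \<ge> 2" and n: "p + p * (2 * t + p) + t \<le> n\<^sub>0"
  shows "ramsey_arrows (n\<^sub>0 + n\<^sub>1 div 2 + n\<^sub>2 div 2 - 2) [cycle_graph n\<^sub>0, path_graph n\<^sub>1, path_graph n\<^sub>2]"
  unfolding ramsey_arrows_def
proof
  define N where "N = n\<^sub>0 + n\<^sub>1 div 2 + n\<^sub>2 div 2 - 2"
  fix c assume "c \<in> [{..<n\<^sub>0 + n\<^sub>1 div 2 + n\<^sub>2 div 2 - 2}]\<^bsup>2\<^esup>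
      \<rightarrow> {..<length [cycle_graph n\<^sub>0, path_graph n\<^sub>1, path_graph n\<^sub>2]}"
  then have c: "c \<in> [{..<N}]\<^bsup>2\<^esup> \<rightarrow> {..<3}" by (simp add: N_def numeral_3_eq_3)
  have adj: "adj (colour_class N c i) x y \<longleftrightarrow> x < N \<and> y < N \<and> x \<noteq> y \<and> c {x, y} = i" for i x y
    by (auto simp: colour_class_def nsets_def card_insert_if)
  have "contains_copy (colour_class N c 0) (cycle_graph n\<^sub>0)
    \<or> contains_copy (colour_class N c 1) (path_graph n\<^sub>1)
    \<or> contains_copy (colour_class N c 2) (path_graph n\<^sub>2)"
  proof (rule ccontr)
    assume "\<not> ?thesis"
    then have no_cycle: "\<not> contains_copy (colour_class N c 0) (cycle_graph n\<^sub>0)"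
      and no_path: "\<not> (contains_copy (colour_class N c 1) (path_graph n\<^sub>1)
        \<or> contains_copy (colour_class N c 2) (path_graph n\<^sub>2))" by auto
    let ?R = "adj (colour_class N c 0)"
    have "1 * p \<le> 2 ^ p * p" by (intro mult_right_mono) auto
    then have "p \<le> t" unfolding t_def by linarith
    have "n\<^sub>1 div 2 \<ge> 1" "n\<^sub>2 div 2 \<ge> 1" using assms(3,4) by simp_all
    then have "p \<ge> 1" and N: "N = n\<^sub>0 + (p - 1)" unfolding p_def N_def by linarith+
    obtain ys where ys: "cycle_list ?R ys" "set ys \<subseteq> {..<N}" "length ys = n\<^sub>0"
    proof (rule cycle_of_prescribed_length[OF _ _ \<open>p \<ge> 1\<close> \<open>p \<le> t\<close> _ _ n, of ?R "{..<N}"])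
      show "symp ?R" by (auto simp: symp_def insert_commute)
      show "irreflp ?R" by (auto simp: irreflp_def adj)
      show "card {..<N} = n\<^sub>0 + (p - 1)" using N by simp
      show "\<exists>x\<in>S. \<exists>y\<in>T. ?R x y"
        if ST: "S \<subseteq> {..<N}" "T \<subseteq> {..<N}" "S \<inter> T = {}" "card S = p" "card T = t" for S T
      proof (rule ccontr)
        assume none: "\<not> ?thesis"
        have "contains_copy (colour_class N c 1) (path_graph n\<^sub>1)
          \<or> contains_copy (colour_class N c 2) (path_graph n\<^sub>2)"
        proof (rule two_coloured_bipartite_path[of "n\<^sub>1 div 2" "n\<^sub>2 div 2"])
          show "S \<union> T \<subseteq> verts (colour_class N c 1)" "S \<union> T \<subseteq> verts (colour_class N c 2)"
            using ST by (auto simp: colour_class_def)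
          show "finite S" "finite T" using ST finite_subset by blast+
          show "card T > 2 ^ (n\<^sub>1 div 2 + n\<^sub>2 div 2 - 1) * (n\<^sub>1 div 2 + n\<^sub>2 div 2 - 1)"
            using ST by (simp add: t_def p_def)
          show "adj (colour_class N c 1) x y \<or> adj (colour_class N c 2) x y"
            if xy: "x \<in> S" "y \<in> T" for x y
          proof -
            have "x < N" "y < N" "x \<noteq> y" using ST xy by auto
            moreover from this have "c {x, y} < 3"
              using c by (auto simp: Pi_iff nsets_def card_insert_if)
            moreover have "c {x, y} \<noteq> 0" using none xy calculation by (auto simp: adj)
            ultimately show ?thesis by (auto simp: adj)
          qed
        qed (use ST assms(3,4) in \<open>simp_all add: p_def\<close>)
        with no_path show False ..
      qed
    qed auto
    then have "contains_copy (colour_class N c 0) (cycle_graph (length ys))"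
      by (intro contains_copy_cycle_graphI) (auto simp: cycle_list_def colour_class_def)
    with no_cycle ys show False by simp
  qed
  then show "\<exists>i<length [cycle_graph n\<^sub>0, path_graph n\<^sub>1, path_graph n\<^sub>2].
      contains_copy (colour_class (n\<^sub>0 + n\<^sub>1 div 2 + n\<^sub>2 div 2 - 2) c i)
        ([cycle_graph n\<^sub>0, path_graph n\<^sub>1, path_graph n\<^sub>2] ! i)"
    unfolding N_def by (auto simp: numeral_2_eq_2 Ex_less_Suc2)
qed

theorem ramsey_number_cycle_path_path:
  assumes "n\<^sub>1 \<ge> 2" "n\<^sub>2 \<ge> 2"
  shows "\<exists>N. \<forall>n\<^sub>0\<ge>N. ramsey_number [cycle_graph n\<^sub>0, path_graph n\<^sub>1, path_graph n\<^sub>2]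
      = n\<^sub>0 + n\<^sub>1 div 2 + n\<^sub>2 div 2 - 2"
proof -
  define p where "p = n\<^sub>1 div 2 + n\<^sub>2 div 2 - 1"
  define t where "t = 2 ^ p * p + 1"
  have "ramsey_number [cycle_graph n\<^sub>0, path_graph n\<^sub>1, path_graph n\<^sub>2] = n\<^sub>0 + n\<^sub>1 div 2 + n\<^sub>2 div 2 - 2"
    if "n\<^sub>0 \<ge> p + p * (2 * t + p) + t" for n\<^sub>0
    unfolding ramsey_number_def
  proof (rule Least_equality)
    show "ramsey_arrows (n\<^sub>0 + n\<^sub>1 div 2 + n\<^sub>2 div 2 - 2) [cycle_graph n\<^sub>0, path_graph n\<^sub>1, path_graph n\<^sub>2]"
      using ramsey_arrows_large[of n\<^sub>1 n\<^sub>2 n\<^sub>0] that assms unfolding p_def t_def by blast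
    show "n\<^sub>0 + n\<^sub>1 div 2 + n\<^sub>2 div 2 - 2 \<le> k"
      if "ramsey_arrows k [cycle_graph n\<^sub>0, path_graph n\<^sub>1, path_graph n\<^sub>2]" for k
      using that not_ramsey_arrows[of n\<^sub>0 n\<^sub>1 n\<^sub>2 k] assms \<open>n\<^sub>0 \<ge> p + p * (2 * t + p) + t\<close>
      by (force simp: t_def not_less)
  qed
  then show ?thesis by blast
qed

theorem theorem8:
  fixes s m n\<^sub>1 n\<^sub>2 :: nat
  assumes "s \<ge> 1" and "m \<ge> 1"
    and "(n\<^sub>1 = 2 * s \<and> n\<^sub>2 = 2 * m \<and> m - 1 < 2 * s)
       \<or> (n\<^sub>1 = 2 * s \<and> n\<^sub>2 = 2 * s)
       \<or> (n\<^sub>1 = 2 * s + 1 \<and> n\<^sub>2 = 2 * m \<and> s < m - 1 \<and> m - 1 < 2 * s + 1)"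
  shows "\<exists>N. \<forall>n\<^sub>0\<ge>N.
    ramsey_number [cycle_graph n\<^sub>0, path_graph n\<^sub>1, path_graph n\<^sub>2]
      = n\<^sub>0 + n\<^sub>1 div 2 + n\<^sub>2 div 2 - 2"
  using assms by (intro ramsey_number_cycle_path_path) auto

end
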